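(* Let $(\gamma,\nu_1,\nu_2):I\to\mathbb{R}^3\times\Delta$ and $(\tilde\gamma,\tilde\nu_1,\tilde\nu_2):J\to\mathbb{R}^3\times\Delta$ be framed curves with frame matrix $T=(t_{ij})$, and let $\mathbf{x}(u,v)=\gamma(u)+\tilde\gamma(v)$. Suppose that there exists a smooth function $\theta:I\times J\to\mathbb{R}$ such that $$t_{32}(u,v)\cos\theta(u,v)+t_{31}(u,v)\sin\theta(u,v)=0$$ for all $(u,v)\in I\times J$. Then $(\mathbf{x},\mathbf{n},\mu):I\times J\to\mathbb{R}^3\times\Delta$ is a framed surface, where $$\mathbf{n}(u,v)=\sin\theta(u,v)\,\nu_1(u)+\cos\theta(u,v)\,\nu_2(u),\qquad \mu(u,v)=\nu_1(u)\times\nu_2(u)=\mu(u).$$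
   Context: All maps are $C^\infty$. $I,J\subset\mathbb{R}$ are intervals, with parameters $u\in I$, $v\in J$; subscripts $u,v$ denote derivatives. $S^2$ is the unit sphere in $\mathbb{R}^3$ and $\Delta=\{(a,b)\in S^2\times S^2 : a\cdot b=0\}$. A framed curve is a smooth map $(\gamma,\nu_1,\nu_2):I\to\mathbb{R}^3\times\Delta$ with $\gamma_u\cdot\nu_1=\gamma_u\cdot\nu_2=0$ on $I$; put $\mu=\nu_1\times\nu_2$, and use tildes for a framed curve on $J$ with parameter $v$. The frame matrix of the two framed curves is $T=(t_{ij}):I\times J\to SO(3)$ determined by $$\begin{pmatrix}\tilde\nu_1(v)\\ \tilde\nu_2(v)\\ \tilde\mu(v)\end{pmatrix}=T(u,v)\begin{pmatrix}\nu_1(u)\\ \nu_2(u)\\ \mu(u)\end{pmatrix}.$$ A smooth map $(\mathbf{x},\mathbf{n},\mathbf{s}):U\to\mathbb{R}^3\times\Delta$ on a simply connected domain $U$ is a framed surface if $\mathbf{x}_u\cdot\mathbf{n}=\mathbf{x}_v\cdot\mathbf{n}=0$ on $U$. *)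

theory Defs
  imports "HOL-Analysis.Analysis"
begin

text \<open>
  C-infinity maps on a set that need not be open: all iterated derivatives, taken within the set,
  exist and are continuous. The derivatives of \<open>f\<close> are followed through the directional derivatives
  \<open>\<lambda>x. f' x w\<close>, whose codomain is again that of \<open>f\<close>. On an open set this is the usual notion;
  at the end points of an interval, or on the boundary of a product of intervals, the derivatives
  are one-sided. Derivatives within such sets (which are nondegenerate below) are unique, so the
  existential quantifier involves no choice.
\<close>

primrec Ck_on :: "nat \<Rightarrow> 'a::real_normed_vector set \<Rightarrow> ('a \<Rightarrow> 'b::real_normed_vector) \<Rightarrow> bool" where
  "Ck_on 0 S f \<longleftrightarrow> continuous_on S f"
| "Ck_on (Suc k) S f \<longleftrightarrow>
     (\<exists>f'. (\<forall>x\<in>S. (f has_derivative f' x) (at x within S)) \<and> (\<forall>w. Ck_on k S (\<lambda>x. f' x w)))"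

definition smooth_on :: "'a::real_normed_vector set \<Rightarrow> ('a \<Rightarrow> 'b::real_normed_vector) \<Rightarrow> bool" where
  "smooth_on S f \<longleftrightarrow> (\<forall>k. Ck_on k S f)"

definition Delta :: "((real^3) \<times> (real^3)) set" where
  "Delta = {(a, b). a \<in> sphere 0 1 \<and> b \<in> sphere 0 1 \<and> a \<bullet> b = 0}"

text \<open>
  Intervals may be open, closed, half-open or unbounded, but not empty or a single point, since
  derivatives with respect to the parameter are taken on them.
\<close>

definition param_interval :: "real set \<Rightarrow> bool" where
  "param_interval I \<longleftrightarrow> is_interval I \<and> interior I \<noteq> {}"

definition framed_curve ::
    "real set \<Rightarrow> (real \<Rightarrow> real^3) \<Rightarrow> (real \<Rightarrow> real^3) \<Rightarrow> (real \<Rightarrow> real^3) \<Rightarrow> bool" where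
  "framed_curve I \<gamma> \<nu>1 \<nu>2 \<longleftrightarrow>
     param_interval I \<and>
     smooth_on I (\<lambda>u. (\<gamma> u, \<nu>1 u, \<nu>2 u)) \<and>
     (\<forall>u\<in>I. (\<nu>1 u, \<nu>2 u) \<in> Delta) \<and>
     (\<forall>u\<in>I. vector_derivative \<gamma> (at u within I) \<bullet> \<nu>1 u = 0 \<and>
            vector_derivative \<gamma> (at u within I) \<bullet> \<nu>2 u = 0)"

definition frame_mu :: "(real \<Rightarrow> real^3) \<Rightarrow> (real \<Rightarrow> real^3) \<Rightarrow> real \<Rightarrow> real^3" where
  "frame_mu \<nu>1 \<nu>2 u = cross3 (\<nu>1 u) (\<nu>2 u)"

text \<open>The 3 by 3 matrix whose rows are the three vectors of the frame at \<open>u\<close>.\<close>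

definition frame_rows :: "(real \<Rightarrow> real^3) \<Rightarrow> (real \<Rightarrow> real^3) \<Rightarrow> real \<Rightarrow> real^3^3" where
  "frame_rows \<nu>1 \<nu>2 u = vector [\<nu>1 u, \<nu>2 u, frame_mu \<nu>1 \<nu>2 u]"

definition is_frame_matrix ::
    "real set \<Rightarrow> real set \<Rightarrow> (real \<Rightarrow> real^3) \<Rightarrow> (real \<Rightarrow> real^3) \<Rightarrow>
     (real \<Rightarrow> real^3) \<Rightarrow> (real \<Rightarrow> real^3) \<Rightarrow> (real \<times> real \<Rightarrow> real^3^3) \<Rightarrow> bool" where
  "is_frame_matrix I J \<nu>1 \<nu>2 \<nu>1' \<nu>2' T \<longleftrightarrow>
     (\<forall>u\<in>I. \<forall>v\<in>J. rotation_matrix (T (u, v)) \<and>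
                   frame_rows \<nu>1' \<nu>2' v = T (u, v) ** frame_rows \<nu>1 \<nu>2 u)"

text \<open>
  Simply connected domains, together with part of their boundary so that products \<open>I \<times> J\<close> of
  arbitrary intervals are included. The last condition says that both partial derivatives make
  sense at every point. For open \<open>U\<close> the predicate amounts to \<open>U\<close> being nonempty and simply
  connected, see \<open>open_simply_connected_domain\<close> below.
\<close>

definition simply_connected_domain :: "(real \<times> real) set \<Rightarrow> bool" where
  "simply_connected_domain U \<longleftrightarrow>
     U \<noteq> {} \<and> simply_connected U \<and> connected (interior U) \<and> U \<subseteq> closure (interior U) \<and>
     (\<forall>u v. (u, v) \<in> U \<longrightarrow> u islimpt {s. (s, v) \<in> U} \<and> v islimpt {t. (u, t) \<in> U})"

definition partial_u :: "(real \<times> real) set \<Rightarrow> (real \<times> real \<Rightarrow> real^3) \<Rightarrow> real \<times> real \<Rightarrow> real^3" where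
  "partial_u U f = (\<lambda>(u, v). vector_derivative (\<lambda>s. f (s, v)) (at u within {s. (s, v) \<in> U}))"

definition partial_v :: "(real \<times> real) set \<Rightarrow> (real \<times> real \<Rightarrow> real^3) \<Rightarrow> real \<times> real \<Rightarrow> real^3" where
  "partial_v U f = (\<lambda>(u, v). vector_derivative (\<lambda>t. f (u, t)) (at v within {t. (u, t) \<in> U}))"

definition framed_surface ::
    "(real \<times> real) set \<Rightarrow> (real \<times> real \<Rightarrow> real^3) \<Rightarrow> (real \<times> real \<Rightarrow> real^3) \<Rightarrow>
     (real \<times> real \<Rightarrow> real^3) \<Rightarrow> bool" where
  "framed_surface U x n s \<longleftrightarrow>
     simply_connected_domain U \<and>
     smooth_on U (\<lambda>p. (x p, n p, s p)) \<and>
     (\<forall>p\<in>U. (n p, s p) \<in> Delta) \<and>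
     (\<forall>p\<in>U. partial_u U x p \<bullet> n p = 0 \<and> partial_v U x p \<bullet> n p = 0)"

lemma open_simply_connected_domain:
  assumes "open U"
  shows "simply_connected_domain U \<longleftrightarrow> U \<noteq> {} \<and> simply_connected U"
proof -
  have "open {s. (s, v) \<in> U}" for v
    using open_vimage[OF assms, of "\<lambda>s. (s, v)"] by (simp add: vimage_def continuous_on_Pair)
  moreover have "open {t. (u, t) \<in> U}" for u
    using open_vimage[OF assms, of "\<lambda>t. (u, t)"] by (simp add: vimage_def continuous_on_Pair)
  ultimately have "u islimpt {s. (s, v) \<in> U} \<and> v islimpt {t. (u, t) \<in> U}" if "(u, v) \<in> U" for u v
    using that open_imp_islimpt by blast
  then show ?thesis
    using assms unfolding simply_connected_domain_def
    by (auto simp: interior_open closure_subset simply_connected_imp_connected)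
qed

lemma param_interval_Times_domain:
  assumes "param_interval I" "param_interval J"
  shows "simply_connected_domain (I \<times> J)"
proof -
  have conv: "convex I" "convex J" and int: "interior I \<noteq> {}" "interior J \<noteq> {}"
    using assms by (auto simp: param_interval_def is_interval_convex)
  have limpt: "x islimpt K" if K: "convex K" "interior K \<noteq> {}" "x \<in> K" for x :: real and K
  proof -
    have "K \<noteq> {x}" using K by auto
    then show ?thesis
      using K convex_connected connected_imp_perfect by blast
  qed
  have c: "convex (I \<times> J)" using conv by (rule convex_Times)
  have i: "interior (I \<times> J) \<noteq> {}" using int by (simp add: interior_Times)
  have "u islimpt {s. (s, v) \<in> I \<times> J} \<and> v islimpt {t. (u, t) \<in> I \<times> J}"
    if "(u, v) \<in> I \<times> J" for u v
    using that limpt conv int by auto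
  then show ?thesis
    unfolding simply_connected_domain_def
    using c i convex_imp_simply_connected[OF c] convex_closure_interior[OF c i]
      convex_connected[OF convex_interior[OF c]] closure_subset[of "I \<times> J"] interior_subset
    by blast
qed

end

theory Submission
  imports Defs
begin

text \<open>
  The derivative of the second curve is orthogonal to its frame vectors, hence a multiple of
  their cross product. The component of that product along \<open>n\<close> is exactly the left-hand side of
  the hypothesis on \<open>\<theta>\<close>, because the third row of \<open>T\<close> expands it in the first frame.
\<close>

text \<open>\<open>Ck_on\<close> demands continuity explicitly only at the last level; below that it
  comes from differentiability. The product rule needs this, since undifferentiated factors reappear
  in it at lower order.\<close>

lemma Ck_on_SucD: "Ck_on (Suc k) S f \<Longrightarrow> Ck_on k S f"
proof (induction k arbitrary: f)
  case 0
  then show ?case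
    by (auto simp: continuous_on_eq_continuous_within intro: has_derivative_continuous)
next
  case (Suc k)
  \<comment> \<open>Only the outer successor is unfolded, so that the directional derivatives keep
    the form the induction hypothesis expects.\<close>
  from Suc.prems obtain f' where
    "\<forall>x\<in>S. (f has_derivative f' x) (at x within S)" "\<forall>w. Ck_on (Suc k) S (\<lambda>x. f' x w)"
    by (subst (asm) Ck_on.simps(2)) blast
  then show ?case using Suc.IH by auto
qed

lemma Ck_on_add:
  "Ck_on k S f \<Longrightarrow> Ck_on k S g \<Longrightarrow> Ck_on k S (\<lambda>x. f x + g x)"
proof (induction k arbitrary: f g)
  case 0
  then show ?case by (auto intro: continuous_intros)
next
  case (Suc k)
  from Suc.prems obtain f' g' where
    "\<forall>x\<in>S. (f has_derivative f' x) (at x within S)" "\<forall>w. Ck_on k S (\<lambda>x. f' x w)"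
    "\<forall>x\<in>S. (g has_derivative g' x) (at x within S)" "\<forall>w. Ck_on k S (\<lambda>x. g' x w)"
    by auto
  then show ?case
    using Suc.IH by (auto intro!: exI[of _ "\<lambda>x w. f' x w + g' x w"] has_derivative_add)
qed

lemma Ck_on_Pair:
  "Ck_on k S f \<Longrightarrow> Ck_on k S g \<Longrightarrow> Ck_on k S (\<lambda>x. (f x, g x))"
proof (induction k arbitrary: f g)
  case 0
  then show ?case by (auto intro: continuous_intros)
next
  case (Suc k)
  from Suc.prems obtain f' g' where
    "\<forall>x\<in>S. (f has_derivative f' x) (at x within S)" "\<forall>w. Ck_on k S (\<lambda>x. f' x w)"
    "\<forall>x\<in>S. (g has_derivative g' x) (at x within S)" "\<forall>w. Ck_on k S (\<lambda>x. g' x w)"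
    by auto
  then show ?case
    using Suc.IH by (auto intro!: exI[of _ "\<lambda>x w. (f' x w, g' x w)"] has_derivative_Pair)
qed

lemma Ck_on_bounded_linear:
  assumes "bounded_linear L"
  shows "Ck_on k S f \<Longrightarrow> Ck_on k S (\<lambda>x. L (f x))"
proof (induction k arbitrary: f)
  case 0
  then show ?case using bounded_linear.continuous_on[OF assms] by auto
next
  case (Suc k)
  from Suc.prems obtain f' where
    "\<forall>x\<in>S. (f has_derivative f' x) (at x within S)" "\<forall>w. Ck_on k S (\<lambda>x. f' x w)"
    by auto
  then show ?case
    using Suc.IH
    by (auto intro!: exI[of _ "\<lambda>x w. L (f' x w)"] bounded_linear.has_derivative[OF assms])
qed

text \<open>One product rule serves multiplication, scaling and the cross product. Each of its terms
  pairs a derivative with an undifferentiated factor, and \<open>low\<close> supplies the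
  latter.\<close>

lemma Ck_on_bounded_bilinear:
  assumes "bounded_bilinear B"
  shows "Ck_on k S f \<Longrightarrow> Ck_on k S g \<Longrightarrow> Ck_on k S (\<lambda>x. B (f x) (g x))"
proof (induction k arbitrary: f g)
  case 0
  then show ?case using bounded_bilinear.continuous_on[OF assms] by auto
next
  case (Suc k)
  have low: "Ck_on k S f" "Ck_on k S g"
    using Suc.prems by (blast dest: Ck_on_SucD)+
  from Suc.prems obtain f' g' where
    "\<forall>x\<in>S. (f has_derivative f' x) (at x within S)" "\<forall>w. Ck_on k S (\<lambda>x. f' x w)"
    "\<forall>x\<in>S. (g has_derivative g' x) (at x within S)" "\<forall>w. Ck_on k S (\<lambda>x. g' x w)"
    by auto
  then show ?case
    using Suc.IH low
    by (auto intro!: exI[of _ "\<lambda>x w. B (f x) (g' x w) + B (f' x w) (g x)"] Ck_on_add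
        bounded_bilinear.FDERIV[OF assms])
qed

text \<open>For linear \<open>L\<close> the derivative in direction \<open>w\<close> is the
  derivative of \<open>f\<close> in the constant direction \<open>L w\<close>, again composed with
  \<open>L\<close>, so the induction closes. It is used for the projections of the parameter
  rectangle.\<close>

lemma Ck_on_compose_bounded_linear:
  assumes "bounded_linear L" "L ` S \<subseteq> S'"
  shows "Ck_on k S' f \<Longrightarrow> Ck_on k S (\<lambda>x. f (L x))"
proof (induction k arbitrary: f)
  case 0
  then show ?case
    using continuous_on_compose2[OF _ bounded_linear.continuous_on[OF assms(1) continuous_on_id]] assms(2)
    by auto
next
  case (Suc k)
  from Suc.prems obtain f' where f':
    "\<And>x. x \<in> S' \<Longrightarrow> (f has_derivative f' x) (at x within S')" "\<And>w. Ck_on k S' (\<lambda>x. f' x w)"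
    by auto
  have "((\<lambda>x. f (L x)) has_derivative (\<lambda>w. f' (L x) (L w))) (at x within S)" if "x \<in> S" for x
    using has_derivative_in_compose2[OF f'(1) assms(2) that
        bounded_linear_imp_has_derivative[OF assms(1)]] .
  moreover have "Ck_on k S (\<lambda>x. f' (L x) (L w))" for w
    using Suc.IH[OF f'(2)] .
  ultimately show ?case
    by (auto intro!: exI[of _ "\<lambda>x w. f' (L x) (L w)"])
qed

text \<open>Each function occurs in the derivative of the other, hence the joint induction.\<close>

lemma Ck_on_sin_cos:
  fixes h :: "'a::real_normed_vector \<Rightarrow> real"
  shows "Ck_on k S h \<Longrightarrow> Ck_on k S (\<lambda>x. sin (h x)) \<and> Ck_on k S (\<lambda>x. cos (h x))"
proof (induction k)
  case 0
  then show ?case by (auto intro: continuous_intros)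
next
  case (Suc k)
  have IH: "Ck_on k S (\<lambda>x. sin (h x))" "Ck_on k S (\<lambda>x. cos (h x))"
    using Suc.IH Ck_on_SucD[OF Suc.prems] by auto
  from Suc.prems obtain h' where h':
    "\<forall>x\<in>S. (h has_derivative h' x) (at x within S)" "\<forall>w. Ck_on k S (\<lambda>x. h' x w)"
    by auto
  note mult = Ck_on_bounded_bilinear[OF bounded_bilinear_mult]
  have "Ck_on (Suc k) S (\<lambda>x. sin (h x))"
    using h' IH
    by (auto intro!: exI[of _ "\<lambda>x w. h' x w * cos (h x)"] mult derivative_eq_intros)
  moreover have "Ck_on k S (\<lambda>x. - sin (h x))"
    using Ck_on_bounded_linear[OF bounded_linear_minus[OF bounded_linear_ident] IH(1)] by simp
  \<comment> \<open>The sign stays attached to the sine, so that the derivative remains a product to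
    which \<open>mult\<close> applies.\<close>
  then have "Ck_on (Suc k) S (\<lambda>x. cos (h x))"
    using h' IH
    by (auto intro!: exI[of _ "\<lambda>x w. h' x w * - sin (h x)"] mult derivative_eq_intros
        simp del: mult_minus_right)
  ultimately show ?case ..
qed

lemma smooth_on_has_vector_derivative:
  assumes "smooth_on I f" "u \<in> I"
  shows "(f has_vector_derivative vector_derivative f (at u within I)) (at u within I)"
proof -
  have "Ck_on (Suc 0) I f" using assms(1) unfolding smooth_on_def by blast
  then have "f differentiable (at u within I)"
    using assms(2) by (auto simp: differentiable_def)
  then show ?thesis by (simp add: vector_derivative_works)
qed

text \<open>This makes derivatives within the interval unique, including one-sided ones at end
  points.\<close>

lemma param_interval_at_within:
  assumes "param_interval I" "u \<in> I"
  shows "at u within I \<noteq> bot"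
proof -
  have "I \<noteq> {u}" using assms by (auto simp: param_interval_def)
  then have "u islimpt I"
    using assms connected_imp_perfect is_interval_connected by (auto simp: param_interval_def)
  then show ?thesis by (simp add: trivial_limit_within)
qed

text \<open>With one parameter frozen, the surface is a curve plus a constant; its partial
  derivatives are therefore those of the two curves.\<close>

lemma vector_derivative_translate:
  assumes "param_interval I" "smooth_on I f" "u \<in> I"
  shows "vector_derivative (\<lambda>s. f s + c) (at u within I) = vector_derivative f (at u within I)"
  using smooth_on_has_vector_derivative[OF assms(2,3)] param_interval_at_within[OF assms(1,3)]
  by (auto intro!: vector_derivative_within derivative_eq_intros)

text \<open>With m = a x b, the triple product w x m = (w.b) a - (w.a) b vanishes, so w is parallel
  to m. Expanding m x (w x m) = (m.m) w - (m.w) m gives the coefficient.\<close>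

lemma orthogonal_complement_cross3:
  assumes "w \<bullet> a = 0" "w \<bullet> b = 0" "norm (cross3 a b) = 1"
  shows "w = (w \<bullet> cross3 a b) *\<^sub>R cross3 a b"
proof -
  define m where "m = cross3 a b"
  have "cross3 w m = 0" using assms(1,2) by (simp add: m_def Lagrange)
  then have "(m \<bullet> m) *\<^sub>R w - (m \<bullet> w) *\<^sub>R m = 0" using Lagrange[of m w m] by simp
  moreover have "m \<bullet> m = 1" using assms(3) by (simp add: m_def dot_square_norm)
  ultimately show ?thesis unfolding m_def[symmetric] by (simp add: inner_commute)
qed

text \<open>From |a x b|^2 + (a.b)^2 = |a|^2 |b|^2 the squared norm is 1; nonnegativity of the norm
  excludes the root -1.\<close>

lemma norm_cross3_orthonormal:
  assumes "(a, b) \<in> Delta"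
  shows "norm (cross3 a b) = 1"
  using assms norm_cross_dot[of a b] by (simp add: Delta_def power2_eq_1_iff) (smt (verit) norm_ge_zero)

theorem proposition4p1:
  fixes I J :: "real set"
    and \<gamma> \<nu>1 \<nu>2 \<gamma>' \<nu>1' \<nu>2' :: "real \<Rightarrow> real^3"
    and T :: "real \<times> real \<Rightarrow> real^3^3"
    and \<theta> :: "real \<times> real \<Rightarrow> real"
  assumes "framed_curve I \<gamma> \<nu>1 \<nu>2"
    and "framed_curve J \<gamma>' \<nu>1' \<nu>2'"
    and "is_frame_matrix I J \<nu>1 \<nu>2 \<nu>1' \<nu>2' T"
    and "smooth_on (I \<times> J) \<theta>"
    and "\<And>u v. u \<in> I \<Longrightarrow> v \<in> J \<Longrightarrow>
           T (u, v) $ 3 $ 2 * cos (\<theta> (u, v)) + T (u, v) $ 3 $ 1 * sin (\<theta> (u, v)) = 0"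
  shows "framed_surface (I \<times> J)
           (\<lambda>(u, v). \<gamma> u + \<gamma>' v)
           (\<lambda>(u, v). sin (\<theta> (u, v)) *\<^sub>R \<nu>1 u + cos (\<theta> (u, v)) *\<^sub>R \<nu>2 u)
           (\<lambda>(u, v). frame_mu \<nu>1 \<nu>2 u)"
proof -
  have I: "param_interval I" "smooth_on I (\<lambda>u. (\<gamma> u, \<nu>1 u, \<nu>2 u))"
    and J: "param_interval J" "smooth_on J (\<lambda>v. (\<gamma>' v, \<nu>1' v, \<nu>2' v))"
    and DeltaI: "\<And>u. u \<in> I \<Longrightarrow> (\<nu>1 u, \<nu>2 u) \<in> Delta"
    and DeltaJ: "\<And>v. v \<in> J \<Longrightarrow> (\<nu>1' v, \<nu>2' v) \<in> Delta"
    using assms(1,2) by (auto simp: framed_curve_def)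
  have sm: "Ck_on k I \<gamma>" "Ck_on k I \<nu>1" "Ck_on k I \<nu>2" for k
    using Ck_on_bounded_linear[OF bounded_linear_fst, of k I "\<lambda>u. (\<gamma> u, \<nu>1 u, \<nu>2 u)"]
      Ck_on_bounded_linear[OF bounded_linear_fst_comp[OF bounded_linear_snd], of k I "\<lambda>u. (\<gamma> u, \<nu>1 u, \<nu>2 u)"]
      Ck_on_bounded_linear[OF bounded_linear_snd_comp[OF bounded_linear_snd], of k I "\<lambda>u. (\<gamma> u, \<nu>1 u, \<nu>2 u)"]
      I(2)
    by (simp_all add: smooth_on_def)
  have sm': "Ck_on k J \<gamma>'" for k
    using Ck_on_bounded_linear[OF bounded_linear_fst, of k J "\<lambda>v. (\<gamma>' v, \<nu>1' v, \<nu>2' v)"] J(2)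
    by (simp add: smooth_on_def)
  have fst: "Ck_on k (I \<times> J) (\<lambda>p. f (fst p))" if "Ck_on k I f" for k and f :: "real \<Rightarrow> real^3"
    using that by (intro Ck_on_compose_bounded_linear[OF bounded_linear_fst, of _ I]) auto
  have snd: "Ck_on k (I \<times> J) (\<lambda>p. f (snd p))" if "Ck_on k J f" for k and f :: "real \<Rightarrow> real^3"
    using that by (intro Ck_on_compose_bounded_linear[OF bounded_linear_snd, of _ J]) auto
  have \<theta>: "Ck_on k (I \<times> J) \<theta>" for k using assms(4) by (simp add: smooth_on_def)
  have ortho: "\<nu>1 u \<bullet> \<nu>1 u = 1" "\<nu>2 u \<bullet> \<nu>2 u = 1" "\<nu>1 u \<bullet> \<nu>2 u = 0" "\<nu>2 u \<bullet> \<nu>1 u = 0"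
    if "u \<in> I" for u
    using DeltaI[OF that] by (simp_all add: Delta_def dot_square_norm inner_commute[of "\<nu>2 u"])
  let ?x = "\<lambda>(u, v). \<gamma> u + \<gamma>' v"
  let ?n = "\<lambda>(u, v). sin (\<theta> (u, v)) *\<^sub>R \<nu>1 u + cos (\<theta> (u, v)) *\<^sub>R \<nu>2 u"
  let ?m = "\<lambda>(u, v). frame_mu \<nu>1 \<nu>2 u"
  have cross: "bounded_bilinear cross3"
    using bilinear_cross by (simp add: bilinear_conv_bounded_bilinear)
  \<comment> \<open>Unfolding the pair patterns exposes \<open>fst p\<close> and
    \<open>snd p\<close>, so each one-parameter ingredient is a pullback along a projection and the
    closure lemmas assemble the rest.\<close>
  have "smooth_on (I \<times> J) (\<lambda>p. (?x p, ?n p, ?m p))"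
    unfolding smooth_on_def case_prod_unfold frame_mu_def
    using Ck_on_sin_cos[OF \<theta>]
    by (auto intro!: Ck_on_Pair Ck_on_add Ck_on_bounded_bilinear[OF bounded_bilinear_scaleR]
        Ck_on_bounded_bilinear[OF cross] fst snd sm sm')
  moreover have "(?n p, ?m p) \<in> Delta" if "p \<in> I \<times> J" for p
  proof -
    obtain u v where p: "p = (u, v)" "u \<in> I" "v \<in> J" using \<open>p \<in> I \<times> J\<close> by auto
    have "?n p \<bullet> ?n p = 1"
      using ortho[OF p(2)]
      by (simp add: p(1) inner_add_left inner_add_right power2_eq_square[symmetric])
    then have "norm (?n p) = 1" by (simp only: norm_eq_1)
    moreover have "?n p \<bullet> ?m p = 0"
      by (simp add: p(1) frame_mu_def inner_add_left dot_cross_self)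
    ultimately show ?thesis
      using norm_cross3_orthonormal[OF DeltaI[OF p(2)]]
      by (simp add: Delta_def p(1) frame_mu_def)
  qed
  moreover have "partial_u (I \<times> J) ?x p \<bullet> ?n p = 0 \<and> partial_v (I \<times> J) ?x p \<bullet> ?n p = 0"
    if "p \<in> I \<times> J" for p
  proof -
    obtain u v where p: "p = (u, v)" "u \<in> I" "v \<in> J" using \<open>p \<in> I \<times> J\<close> by auto
    have pu: "partial_u (I \<times> J) ?x p = vector_derivative \<gamma> (at u within I)"
      using vector_derivative_translate[OF I(1) _ p(2), of \<gamma>] sm p
      by (simp add: partial_u_def smooth_on_def)
    have pv: "partial_v (I \<times> J) ?x p = vector_derivative \<gamma>' (at v within J)"
      using vector_derivative_translate[OF J(1) _ p(3), of \<gamma>'] sm' p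
      by (simp add: partial_v_def smooth_on_def add.commute)
    \<comment> \<open>This is the third frame vector of the second curve, that is, the third row of
      its frame matrix of rows.\<close>
    define m where "m = cross3 (\<nu>1' v) (\<nu>2' v)"
    have "frame_rows \<nu>1' \<nu>2' v = T p ** frame_rows \<nu>1 \<nu>2 u"
      using assms(3) p by (simp add: is_frame_matrix_def)
    then have "frame_rows \<nu>1' \<nu>2' v $ 3 = (T p ** frame_rows \<nu>1 \<nu>2 u) $ 3" by simp
    then have "m = T p $ 3 $ 1 *\<^sub>R \<nu>1 u + T p $ 3 $ 2 *\<^sub>R \<nu>2 u + T p $ 3 $ 3 *\<^sub>R frame_mu \<nu>1 \<nu>2 u"
      by (simp add: frame_rows_def m_def frame_mu_def matrix_matrix_mult_def vec_eq_iff sum_3)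
    \<comment> \<open>The t33 term drops out because \<mu> is orthogonal to both \<nu>1 and \<nu>2,
      which span the plane containing n.\<close>
    then have "m \<bullet> ?n p = T p $ 3 $ 1 * sin (\<theta> p) + T p $ 3 $ 2 * cos (\<theta> p)"
      using ortho[OF p(2)]
      by (simp add: p(1) frame_mu_def inner_add_left inner_add_right dot_cross_self)
    then have mn: "m \<bullet> ?n p = 0" using assms(5)[OF p(2,3)] p(1) by simp
    have "vector_derivative \<gamma>' (at v within J)
        = (vector_derivative \<gamma>' (at v within J) \<bullet> m) *\<^sub>R m"
      unfolding m_def using assms(2) p norm_cross3_orthonormal[OF DeltaJ[OF p(3)]]
      by (intro orthogonal_complement_cross3) (auto simp: framed_curve_def)
    \<comment> \<open>The left side of the equation recurs inside its right side, so rewriting with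
      it would loop; congruence applies it exactly once.\<close>
    then have "vector_derivative \<gamma>' (at v within J) \<bullet> ?n p
        = (vector_derivative \<gamma>' (at v within J) \<bullet> m) *\<^sub>R m \<bullet> ?n p"
      by (rule arg_cong)
    then have "vector_derivative \<gamma>' (at v within J) \<bullet> ?n p = 0"
      by (simp only: inner_scaleR_left mn mult_zero_right)
    \<comment> \<open>In the u direction no condition on \<theta> enters: n is a combination of
      \<nu>1 and \<nu>2, both orthogonal to the derivative of \<gamma>.\<close>
    moreover have "vector_derivative \<gamma> (at u within I) \<bullet> ?n p = 0"
      using assms(1) p by (simp add: framed_curve_def inner_add_right)
    ultimately show ?thesis by (simp only: pu pv)
  qed
  ultimately show ?thesis
    using param_interval_Times_domain[OF I(1) J(1)] by (auto simp: framed_surface_def)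
qed

end
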